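(* Let $p,q\in\mathbb{Z}$ be odd primes. Then $$\left(\frac{p}{q}\right)\left(\frac{q}{p}\right)=(-1)^{\frac{p-1}{2}\cdot\frac{q-1}{2}}.$$ Alternatively, this can be expressed as: $\left(\frac{p}{q}\right)=\left(\frac{q}{p}\right)$ if $p\equiv 1\pmod 4$ or $q\equiv 1\pmod 4$, and $\left(\frac{p}{q}\right)=-\left(\frac{q}{p}\right)$ if $p\equiv 3\pmod 4$ and $q\equiv 3\pmod 4$.
   Context: $\left(\frac{a}{p}\right)$ denotes the Legendre symbol of the integer $a$ modulo the odd prime $p$.
   Formalization: The product formula is stated only for distinct odd primes p and q, because for p = q both Legendre symbols are 0 while the right-hand side is 1 or -1; the two congruence cases are stated for all odd primes. *)

theory Defs
  imports "HOL-Number_Theory.Number_Theory"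
begin

end

theory Submission
  imports Defs
begin

text \<open>For distinct primes the product formula is the library's
  \<open>Quadratic_Reciprocity_int\<close>. The case form follows from the parity of the exponent,
  which is odd exactly when both primes are 3 mod 4. A nonzero symbol is its own inverse
  (\<open>Legendre_sq_eq_1\<close>), so one factor of the product can be moved to the other
  side.\<close>

lemma Legendre_sq_eq_1:
  assumes "\<not> [a = 0] (mod p)"
  shows "Legendre a p * Legendre a p = 1"
  using assms by (simp add: Legendre_def)

theorem theorem0p6:
  fixes p q :: int
  assumes "prime p" and "odd p" and "prime q" and "odd q"
  shows "(p \<noteq> q \<longrightarrow>
           Legendre p q * Legendre q p = (- 1) ^ nat ((p - 1) div 2 * ((q - 1) div 2))) \<and>
         ([p = 1] (mod 4) \<or> [q = 1] (mod 4) \<longrightarrow> Legendre p q = Legendre q p) \<and>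
         ([p = 3] (mod 4) \<and> [q = 3] (mod 4) \<longrightarrow> Legendre p q = - Legendre q p)"
proof (cases "p = q")
  case True
  \<comment> \<open>The symbols are then all 0, which is its own negative.\<close>
  then show ?thesis
    by (auto simp: Legendre_def cong_def)
next
  case False
  have "p > 2" "q > 2"
    using assms prime_ge_2_int[of p] prime_ge_2_int[of q] by (auto simp: order_le_less)
  have "\<not> p dvd q"
    using False assms primes_dvd_imp_eq by blast
  then have sq: "Legendre q p * Legendre q p = 1"
    by (intro Legendre_sq_eq_1) (simp add: cong_0_iff)
  have rec: "Legendre p q * Legendre q p = (- 1) ^ nat ((p - 1) div 2 * ((q - 1) div 2))"
    using assms \<open>p > 2\<close> \<open>q > 2\<close> False
    by (intro Quadratic_Reciprocity_int) simp_all
  have half: "even ((x - 1) div 2) \<longleftrightarrow> [x = 1] (mod 4)" if "odd x" for x :: int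
    using that unfolding cong_def by presburger
  \<comment> \<open>As \<open>p\<close> and \<open>q\<close> exceed 2, the exponent is nonnegative,
    so \<open>nat\<close> keeps its parity; it is even iff one of its two factors is.\<close>
  have sign: "(- 1 :: int) ^ nat ((p - 1) div 2 * ((q - 1) div 2)) =
      (if [p = 1] (mod 4) \<or> [q = 1] (mod 4) then 1 else - 1)"
    using half[OF assms(2)] half[OF assms(4)] \<open>p > 2\<close> \<open>q > 2\<close>
    by (simp add: minus_one_power_iff even_nat_iff)
  have eq: "Legendre p q = s * Legendre q p" if "Legendre p q * Legendre q p = s" for s
  proof -
    have "Legendre p q * (Legendre q p * Legendre q p) = s * Legendre q p"
      unfolding that[symmetric] by (rule mult.assoc[symmetric])
    then show ?thesis
      by (simp only: sq mult_1_right)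
  qed
  \<comment> \<open>Selects the branch -1 in \<open>sign\<close> when both primes are 3 mod
    4.\<close>
  have "\<not> [x = 1] (mod 4)" if "[x = 3] (mod 4)" for x :: int
    using that by (simp add: cong_def)
  then show ?thesis
    using rec eq[OF rec] unfolding sign by simp
qed

end
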